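(* Let $R$ be an integral domain of characteristic $0$ with field of fractions $K$, let $m\ge 2$ be an integer, and let $$\varphi(x)=x^m\sum_{k=0}^\infty b_kx^k\in R[[x]]\quad\text{with } b_0=1.$$ Let $f_\varphi(x)\in x+x^2K[[x]]$ be the Böttcher coordinate of $\varphi$, i.e. the unique such power series satisfying $\varphi(f_\varphi(x))=f_\varphi(x^m)$, and let $f_\varphi^{-1}(x)\in x+x^2K[[x]]$ be its inverse under composition. (a) Both $f_\varphi(x)$ and $f_\varphi^{-1}(x)$ are series of the form $$x\sum_{k=0}^\infty \frac{a_k}{m^k\,k!}x^k\quad\text{with } a_0=1 \text{ and } a_k\in R \text{ for all } k.$$ (b) Suppose further that $k!\,b_k\in mR$ for all $1\le k<m$ (for example, this holds if $\varphi(x)\in x^m+mx^{m+1}R[[x]]$). Then both $f_\varphi(x)$ and $f_\varphi^{-1}(x)$ are series of the form $$x\sum_{k=0}^\infty \frac{a_k}{k!}x^k\quad\text{with } a_0=1 \text{ and } a_k\in R \text{ for all } k.$$ (The coefficients $a_k$ may be different for the two series $f_\varphi$ and $f_\varphi^{-1}$, and different in (a) and (b).)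
   Context: Existence and uniqueness of the Böttcher coordinate (well known): if $K$ is a field of characteristic $0$, $m\ge2$, and $\varphi(x)\in x^m+x^{m+1}K[[x]]$, then there is a unique formal power series $f_\varphi(x)\in x+x^2K[[x]]$ with $\varphi\circ f_\varphi(x)=f_\varphi(x^m)$; it is called the (local) Böttcher coordinate of $\varphi$. *)

theory Defs
  imports "HOL-Computational_Algebra.Computational_Algebra"
begin

definition fps_to_fract :: "'a::idom fps \<Rightarrow> 'a fract fps" where
  "fps_to_fract \<phi> = Abs_fps (\<lambda>n. to_fract (\<phi> $ n))"

text \<open>
  The local Boettcher coordinate of a power series \<open>\<phi>\<close> with leading term \<open>x\<^sup>m\<close>. The exponent
  \<open>m\<close> is passed explicitly. The description is proper, i.e. there is exactly one such \<open>f\<close>, if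
  \<open>m \<ge> 2\<close>, the field has characteristic 0 and \<open>\<phi>\<close> has the form \<open>x\<^sup>m + O(x\<^sup>m\<^sup>+\<^sup>1)\<close>.
\<close>

definition boettcher :: "nat \<Rightarrow> 'k::field fps \<Rightarrow> 'k fps" where
  "boettcher m \<phi> = (THE f. f $ 0 = 0 \<and> f $ 1 = 1 \<and> \<phi> oo f = f oo fps_X ^ m)"

end

theory Submission
  imports Defs
begin

text \<open>
  Write \<open>\<phi> = x\<^sup>m b(x)\<close> and \<open>f = x u(x)\<close>. The equation \<open>\<phi> \<circ> f = f(x\<^sup>m)\<close> says \<open>u\<^sup>m B = U\<close> with
  \<open>U = u(x\<^sup>m)\<close> and \<open>B = b(x u)\<close>; by logarithmic differentiation it is equivalent to
  \<open>u' = (u / m) (U' / U - B' / B)\<close> with \<open>u(0) = 1\<close>, whose right-hand side is causal, so that there is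
  exactly one solution. The series \<open>u\<close> with \<open>s\<^sup>k k! u\<^sub>k \<in> R\<close> are characterized by \<open>u(0) \<in> R\<close> and
  recursively by \<open>s u'\<close> being of the same kind. Thus they are closed under products, inverses and
  \<open>u \<mapsto> u(x v)\<close>, and the differential equation bounds the denominators of the coefficients of \<open>u\<close>
  one degree at a time, with \<open>s = m\<close> for (a) and \<open>s = 1\<close> for (b). For the compositional
  inverse \<open>x v\<close> of \<open>f\<close> the same induction applies to \<open>v = 1 / u(x v)\<close>.
\<close>

section \<open>Characteristic zero of the fraction field\<close>

lemma of_nat_fract_eq: "of_nat n = to_fract (of_nat n :: 'a::idom)"
  by (induction n) simp_all

text \<open>Integrating series and dividing by \<open>m\<close> over the fraction field rest on
  this; it holds because the embedding \<open>to_fract\<close> is injective.\<close>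

instance fract :: ("{idom,ring_char_0}") field_char_0
  by standard (rule injI, simp add: of_nat_fract_eq)

subsection \<open>Formal differential equations\<close>

lemma fps_mult_nth_cong:
  fixes u v u' v' :: "'a::semiring_0 fps"
  assumes "\<And>i. i < n \<Longrightarrow> u $ i = u' $ i" "\<And>i. i < n \<Longrightarrow> v $ i = v' $ i" "i < n"
  shows "(u * v) $ i = (u' * v') $ i"
  using assms unfolding fps_mult_nth by (intro sum.cong) auto

lemma fps_power_nth_cong:
  fixes u v :: "'a::semiring_1 fps"
  assumes "\<And>i. i < n \<Longrightarrow> u $ i = v $ i" "i < n"
  shows "(u ^ k) $ i = (v ^ k) $ i"
  using assms(2)
proof (induction k arbitrary: i)
  case (Suc k)
  then show ?case
    unfolding power_Suc by (intro fps_mult_nth_cong[where n = n]) (auto simp: assms(1))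
qed simp

lemma fps_compose_nth_cong_right:
  fixes u v :: "'a::semiring_1 fps"
  assumes "\<And>i. i < n \<Longrightarrow> u $ i = v $ i" "i < n"
  shows "(a oo u) $ i = (a oo v) $ i"
  unfolding fps_compose_nth using fps_power_nth_cong[OF assms] by simp

text \<open>In \<open>inverse u * v * inverse v\<close> the middle factor may be replaced by
  \<open>u\<close> in degrees below \<open>n\<close>, which turns the inverse of \<open>u\<close>
  into that of \<open>v\<close>.\<close>

lemma fps_inverse_nth_cong:
  fixes u v :: "'a::field fps"
  assumes agree: "\<And>i. i < n \<Longrightarrow> u $ i = v $ i" and "u $ 0 \<noteq> 0" "v $ 0 \<noteq> 0" "i < n"
  shows "inverse u $ i = inverse v $ i"
proof -
  have "inverse u = inverse u * (v * inverse v)"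
    using assms by (simp add: inverse_mult_eq_1')
  also have "\<dots> $ i = (inverse u * (u * inverse v)) $ i"
    using assms by (intro fps_mult_nth_cong[where n = n] agree[symmetric]) auto
  also have "inverse u * (u * inverse v) = inverse v"
    using assms by (simp add: inverse_mult_eq_1 flip: mult.assoc)
  finally show ?thesis .
qed

text \<open>Picard iteration: integrating a causal right-hand side determines one more coefficient
  each time, so the iterates stabilize coefficientwise, and two fixed points agree by induction on
  the degree.\<close>

lemma fps_ode_ex1:
  fixes G :: "'k::field_char_0 fps \<Rightarrow> 'k fps"
  assumes causal: "\<And>u v n i. \<lbrakk>u $ 0 = 1; v $ 0 = 1; \<And>i. i < n \<Longrightarrow> u $ i = v $ i; i < n\<rbrakk>
      \<Longrightarrow> G u $ i = G v $ i"
  shows "\<exists>!u. u $ 0 = 1 \<and> fps_deriv u = G u"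
proof -
  define F where "F u = fps_integral (G u) 1" for u
  have F0 [simp]: "F u $ 0 = 1" for u
    by (simp add: F_def)
  have F_iff: "u $ 0 = 1 \<and> fps_deriv u = G u \<longleftrightarrow> u = F u" for u
    unfolding F_def by (metis fps_deriv_fps_integral fps_integral_deriv fps_integral_nth_0_Suc(1))
  have F_cong: "F u $ i = F v $ i"
    if "u $ 0 = 1" "v $ 0 = 1" "\<And>i. i < n \<Longrightarrow> u $ i = v $ i" "i < Suc n" for u v n i
    using that causal[of u v n "i - 1"] by (cases i) (auto simp: F_def)
  define S where "S k = (F ^^ k) 1" for k
  have S_Suc: "S (Suc k) = F (S k)" for k
    by (simp add: S_def)
  have S0: "S k $ 0 = 1" for k
    by (cases k) (simp_all add: S_def)
  have S_step: "S k $ i = S (Suc k) $ i" if "i < k" for i k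
    using that
  proof (induction k arbitrary: i)
    case (Suc k)
    then show ?case
      unfolding S_Suc[of k] S_Suc[of "Suc k"] by (intro F_cong[where n = k] S0) auto
  qed simp
  have S_stable: "S k $ i = S (Suc i) $ i" if "i < k" for i k
    using that
  proof (induction k)
    case (Suc k)
    then show ?case by (cases "i = k") (simp_all flip: S_step)
  qed simp
  \<comment> \<open>The limit is read off diagonally: by \<open>S_stable\<close> coefficient
    \<open>i\<close> is final from iterate \<open>Suc i\<close> on.\<close>
  define u where "u = Abs_fps (\<lambda>i. S (Suc i) $ i)"
  have u0: "u $ 0 = 1"
    by (simp add: u_def S0)
  have "F u $ i = u $ i" for i
  proof -
    have "F u $ i = F (S i) $ i"
      by (rule F_cong[where n = i]) (auto simp: u0 S0 S_stable[of _ i] u_def)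
    then show ?thesis by (simp add: u_def S_Suc)
  qed
  then have "u = F u"
    by (simp add: fps_eq_iff)
  moreover have "v = w" if "v = F v" "w = F w" for v w
  proof -
    have "v $ 0 = 1" "w $ 0 = 1"
      using that F0 by metis+
    have "v $ i = w $ i" for i
    proof (induction i rule: less_induct)
      case (less i)
      have "F v $ i = F w $ i"
        using less \<open>v $ 0 = 1\<close> \<open>w $ 0 = 1\<close> by (intro F_cong[where n = i]) auto
      then show ?case using that by simp
    qed
    then show ?thesis by (simp add: fps_eq_iff)
  qed
  ultimately show ?thesis
    unfolding F_iff by blast
qed

subsection \<open>The logarithmic derivative of the Boettcher equation\<close>

definition boettcher_rhs :: "nat \<Rightarrow> 'k::field_char_0 fps \<Rightarrow> 'k fps \<Rightarrow> 'k fps" where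
  "boettcher_rhs m b u = fps_const (1 / of_nat m) * u *
     (fps_deriv (u oo fps_X ^ m) * inverse (u oo fps_X ^ m) -
      fps_deriv (b oo (fps_X * u)) * inverse (b oo (fps_X * u)))"

text \<open>Forward, differentiate and divide. Backward, the equation makes the derivative of
  \<open>u ^ m * B * inverse U\<close> vanish; in characteristic 0 this quotient is constant, and
  its constant term is 1.\<close>

lemma boettcher_equation_iff_deriv:
  fixes b u :: "'k::field_char_0 fps"
  assumes m: "m \<ge> 1" and b0: "b $ 0 = 1" and u0: "u $ 0 = 1"
  shows "u ^ m * (b oo (fps_X * u)) = u oo fps_X ^ m \<longleftrightarrow> fps_deriv u = boettcher_rhs m b u"
proof -
  define U where "U = u oo fps_X ^ m"
  define B where "B = b oo (fps_X * u)"
  define M :: "'k fps" where "M = fps_const (of_nat m)"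
  define w where "w = u ^ (m - 1)"
  have um: "u ^ m = u * w"
    using m unfolding w_def by (cases m) auto
  have dum: "fps_deriv (u ^ m) = M * fps_deriv u * w"
    by (simp add: fps_deriv_power' M_def w_def fps_of_nat)
  have dP: "fps_deriv (u ^ m * B) = M * fps_deriv u * w * B + u * w * fps_deriv B"
    by (simp add: dum del: mult_cancel_right) (simp add: um)
  have U: "U * inverse U = 1" and B: "B * inverse B = 1"
    using u0 b0 by (simp_all add: U_def B_def inverse_mult_eq_1')
  have "M * fps_const (1 / of_nat m) = 1"
    using m by (simp add: M_def)
  then have rhs: "fps_deriv u = boettcher_rhs m b u \<longleftrightarrow>
      M * fps_deriv u = u * (fps_deriv U * inverse U - fps_deriv B * inverse B)" (is "_ \<longleftrightarrow> ?ode")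
    unfolding boettcher_rhs_def U_def[symmetric] B_def[symmetric]
    by algebra
  have "u ^ m * B = U \<longleftrightarrow> ?ode"
  proof
    assume eq: "u ^ m * B = U"
    then have uwB: "u * w * B = U"
      by (simp add: um)
    have "fps_deriv U = M * fps_deriv u * w * B + u * w * fps_deriv B"
      using dP unfolding eq .
    then show ?ode
      using uwB U B by algebra
  next
    assume ode: ?ode
    have "fps_deriv (u ^ m * B * inverse U) =
        M * fps_deriv u * w * B * inverse U + u * w * fps_deriv B * inverse U
        - u * w * B * fps_deriv U * inverse U * inverse U"
      using u0 unfolding fps_deriv_mult[of "u ^ m * B"] dP
      by (simp add: um fps_inverse_deriv U_def power2_eq_square algebra_simps)
    also have "\<dots> = 0"
      using ode B by algebra
    finally have "u ^ m * B * inverse U = fps_const ((u ^ m * B * inverse U) $ 0)"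
      by (simp only: fps_deriv_eq_0_iff)
    then have "u ^ m * B * inverse U = 1"
      using u0 b0 by (simp add: U_def B_def fps_power_zeroth)
    then show "u ^ m * B = U"
      using U unfolding um by algebra
  qed
  then show ?thesis
    unfolding rhs by (simp add: U_def B_def)
qed

text \<open>The derivatives cost one degree, which both compositions regain: for k > 0, coefficient
  k of u(x^m) involves only u at k div m < k, as m \<ge> 2, and the factor x in x u shifts
  \<open>u\<close> by one.\<close>

lemma boettcher_rhs_causal:
  fixes b u v :: "'k::field_char_0 fps"
  assumes m: "m \<ge> 2" and b0: "b $ 0 = 1" and u0: "u $ 0 = 1" and v0: "v $ 0 = 1"
    and agree: "\<And>i. i < n \<Longrightarrow> u $ i = v $ i" and i: "i < n"
  shows "boettcher_rhs m b u $ i = boettcher_rhs m b v $ i"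
proof -
  have le: "k div m \<le> k" "0 < k \<Longrightarrow> k div m < k" for k
    using m by auto
  have U: "(u oo fps_X ^ m) $ k = (v oo fps_X ^ m) $ k" if "k < Suc n" for k
    using that agree[of "k div m"] le[of k] u0 v0
    by (cases "k = 0") (auto simp: fps_nth_compose_X_power)
  have B: "(b oo (fps_X * u)) $ k = (b oo (fps_X * v)) $ k" if "k < Suc n" for k
    using that by (intro fps_compose_nth_cong_right[where n = "Suc n"]) (auto simp: agree)
  show ?thesis
    unfolding boettcher_rhs_def
  proof (intro fps_mult_nth_cong[where n = n])
    fix k assume "k < n"
    then show "(fps_deriv (u oo fps_X ^ m) * inverse (u oo fps_X ^ m) -
         fps_deriv (b oo (fps_X * u)) * inverse (b oo (fps_X * u))) $ k =
        (fps_deriv (v oo fps_X ^ m) * inverse (v oo fps_X ^ m) -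
         fps_deriv (b oo (fps_X * v)) * inverse (b oo (fps_X * v))) $ k"
      unfolding fps_sub_nth
      by (intro arg_cong2[where f = minus] fps_mult_nth_cong[where n = n]
          fps_inverse_nth_cong[where n = n]) (simp_all add: U B u0 v0 b0)
  qed (simp_all add: agree i)
qed

lemma boettcher_semiconjugacy_iff:
  fixes b u :: "'k::field_char_0 fps"
  assumes m: "m \<ge> 1"
  shows "(fps_X ^ m * b) oo (fps_X * u) = (fps_X * u) oo fps_X ^ m \<longleftrightarrow>
         u ^ m * (b oo (fps_X * u)) = u oo fps_X ^ m"
proof -
  have "(fps_X ^ m * b) oo (fps_X * u) = fps_X ^ m * (u ^ m * (b oo (fps_X * u)))"
    by (simp add: fps_compose_mult_distrib fps_X_power_compose power_mult_distrib mult.assoc)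
  moreover have "(fps_X * u) oo fps_X ^ m = fps_X ^ m * (u oo fps_X ^ m)"
    using m by (simp add: fps_compose_mult_distrib)
  ultimately show ?thesis by simp
qed

text \<open>This resolves the definite description: every candidate has zero constant term, hence
  the form x v, and for such series the functional equation is the differential equation, which has
  exactly one solution.\<close>

lemma boettcher_factorization:
  fixes b :: "'k::field_char_0 fps"
  assumes m: "m \<ge> 2" and b0: "b $ 0 = 1"
  obtains u where "boettcher m (fps_X ^ m * b) = fps_X * u" "u $ 0 = 1"
    "fps_deriv u = boettcher_rhs m b u"
proof -
  let ?P = "\<lambda>f. f $ 0 = 0 \<and> f $ 1 = 1 \<and> (fps_X ^ m * b) oo f = f oo fps_X ^ m"
  have ex1: "\<exists>!u. u $ 0 = 1 \<and> fps_deriv u = boettcher_rhs m b u"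
    by (rule fps_ode_ex1, rule boettcher_rhs_causal[OF m b0])
  then obtain u where u: "u $ 0 = 1" "fps_deriv u = boettcher_rhs m b u"
    by blast
  have iff: "?P (fps_X * v) \<longleftrightarrow> v $ 0 = 1 \<and> fps_deriv v = boettcher_rhs m b v" for v
    using m boettcher_semiconjugacy_iff[of m b v] boettcher_equation_iff_deriv[of m b v] b0 by auto
  have "f = fps_X * u" if "?P f" for f
  proof -
    have f: "f = fps_X * fps_shift 1 f"
      using that by (intro fps_ext) (simp add: not_less_eq gr0_conv_Suc)
    then show ?thesis
      using that iff ex1 u by metis
  qed
  then have "boettcher m (fps_X ^ m * b) = fps_X * u"
    unfolding boettcher_def using iff u by (intro the_equality) auto
  then show ?thesis using that u by blast
qed

subsection \<open>Hurwitz series\<close>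

locale hurwitz_series =
  fixes R :: "'k::field_char_0 set" and s :: nat
  assumes one_mem: "1 \<in> R"
    and diff_mem: "x \<in> R \<Longrightarrow> y \<in> R \<Longrightarrow> x - y \<in> R"
    and mult_mem: "x \<in> R \<Longrightarrow> y \<in> R \<Longrightarrow> x * y \<in> R"
begin

lemma zero_mem: "0 \<in> R"
  using diff_mem[OF one_mem one_mem] by simp

lemma uminus_mem: "x \<in> R \<Longrightarrow> - x \<in> R"
  using diff_mem[OF zero_mem] by simp

lemma add_mem: "x \<in> R \<Longrightarrow> y \<in> R \<Longrightarrow> x + y \<in> R"
  using diff_mem[OF _ uminus_mem] by simp

lemma of_nat_mem: "of_nat n \<in> R"
  by (induction n) (auto intro: zero_mem one_mem add_mem)

text \<open>The bound \<open>n\<close> allows induction on the degree for series that occur on the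
  right-hand side of their own equation.\<close>

definition hurwitz :: "nat \<Rightarrow> 'k fps \<Rightarrow> bool" where
  "hurwitz n u \<longleftrightarrow> (\<forall>i\<le>n. of_nat (s ^ i * fact i) * u $ i \<in> R)"

lemma hurwitz_mono: "hurwitz n u \<Longrightarrow> k \<le> n \<Longrightarrow> hurwitz k u"
  by (auto simp: hurwitz_def)

lemma hurwitz_0: "hurwitz 0 u \<longleftrightarrow> u $ 0 \<in> R"
  by (simp add: hurwitz_def)

text \<open>The factor s (i + 1) from scaled differentiation is exactly the quotient of consecutive
  denominators. Closure properties thus follow by induction from the rules of
  differentiation.\<close>

lemma hurwitz_Suc:
  "hurwitz (Suc n) u \<longleftrightarrow> u $ 0 \<in> R \<and> hurwitz n (fps_const (of_nat s) * fps_deriv u)"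
proof -
  have "hurwitz (Suc n) u \<longleftrightarrow> u $ 0 \<in> R \<and> (\<forall>i\<le>n. of_nat (s ^ Suc i * fact (Suc i)) * u $ Suc i \<in> R)"
    unfolding hurwitz_def
    using All_less_Suc2[of "Suc n" "\<lambda>i. of_nat (s ^ i * fact i) * u $ i \<in> R"]
    by (simp add: less_Suc_eq_le)
  then show ?thesis
    by (simp add: hurwitz_def algebra_simps)
qed

lemma hurwitz_add: "hurwitz n u \<Longrightarrow> hurwitz n v \<Longrightarrow> hurwitz n (u + v)"
  by (auto simp: hurwitz_def distrib_left intro: add_mem)

lemma hurwitz_uminus: "hurwitz n u \<Longrightarrow> hurwitz n (- u)"
  by (auto simp: hurwitz_def intro: uminus_mem)

lemma hurwitz_diff: "hurwitz n u \<Longrightarrow> hurwitz n v \<Longrightarrow> hurwitz n (u - v)"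
  by (auto simp: hurwitz_def right_diff_distrib intro: diff_mem)

lemma hurwitz_mult: "hurwitz n u \<Longrightarrow> hurwitz n v \<Longrightarrow> hurwitz n (u * v)"
proof (induction n arbitrary: u v)
  case 0
  then show ?case by (simp add: hurwitz_0 mult_mem)
next
  case (Suc n)
  let ?s = "fps_const (of_nat s)"
  have "hurwitz n u" "hurwitz n v"
    using Suc.prems by (auto intro: hurwitz_mono)
  moreover have "hurwitz n (?s * fps_deriv u)" "hurwitz n (?s * fps_deriv v)"
    using Suc.prems by (simp_all add: hurwitz_Suc)
  ultimately have "hurwitz n (u * (?s * fps_deriv v) + (?s * fps_deriv u) * v)"
    by (blast intro: hurwitz_add Suc.IH)
  moreover have "?s * fps_deriv (u * v) = u * (?s * fps_deriv v) + (?s * fps_deriv u) * v"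
    by (simp add: algebra_simps)
  ultimately show ?case
    using Suc.prems by (simp add: hurwitz_Suc mult_mem)
qed

lemma hurwitz_inverse:
  assumes "hurwitz n u" "u $ 0 = 1"
  shows "hurwitz n (inverse u)"
  using assms(1)
proof (induction n)
  case 0
  then show ?case using assms by (simp add: hurwitz_0)
next
  case (Suc n)
  let ?s = "fps_const (of_nat s)"
  have IH: "hurwitz n (inverse u)"
    using Suc.IH hurwitz_mono[OF Suc.prems, of n] by simp
  have "?s * fps_deriv (inverse u) = - ((?s * fps_deriv u) * inverse u * inverse u)"
    using assms by (simp add: fps_inverse_deriv power2_eq_square algebra_simps)
  then show ?case
    using IH Suc.prems assms(2) by (auto simp: hurwitz_Suc intro!: hurwitz_uminus hurwitz_mult)
qed

text \<open>Coefficient i of (x u)' is (i + 1) u_i, so neither a degree nor a factor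
  \<open>s\<close> is lost.\<close>

lemma hurwitz_deriv_fps_X_mult:
  assumes "hurwitz n u"
  shows "hurwitz n (fps_deriv (fps_X * u))"
  unfolding hurwitz_def
proof safe
  fix i assume "i \<le> n"
  then have "of_nat (Suc i) * (of_nat (s ^ i * fact i) * u $ i) \<in> R"
    using assms unfolding hurwitz_def by (blast intro: mult_mem of_nat_mem)
  then show "of_nat (s ^ i * fact i) * fps_deriv (fps_X * u) $ i \<in> R"
    by (cases "i = 0") (simp_all add: algebra_simps)
qed

text \<open>Chain rule: the scaling \<open>s\<close> goes to the derivative of \<open>u\<close>, and
  (x v)' needs none. The factor x is why \<open>v\<close> is only required up to degree
  \<open>n - 1\<close>.\<close>

lemma hurwitz_compose_fps_X_mult:
  assumes "hurwitz n u" "hurwitz (n - 1) v"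
  shows "hurwitz n (u oo (fps_X * v))"
  using assms
proof (induction n arbitrary: u)
  case 0
  then show ?case by (simp add: hurwitz_0)
next
  case (Suc n)
  let ?s = "fps_const (of_nat s)"
  have "hurwitz n v"
    using Suc.prems by simp
  then have "hurwitz n ((?s * fps_deriv u) oo (fps_X * v))"
    using Suc.prems by (intro Suc.IH) (auto simp: hurwitz_Suc intro: hurwitz_mono)
  then have "hurwitz n (((?s * fps_deriv u) oo (fps_X * v)) * fps_deriv (fps_X * v))"
    by (rule hurwitz_mult[OF _ hurwitz_deriv_fps_X_mult[OF \<open>hurwitz n v\<close>]])
  moreover have "?s * fps_deriv (u oo (fps_X * v)) =
      ((?s * fps_deriv u) oo (fps_X * v)) * fps_deriv (fps_X * v)"
    by (simp add: fps_compose_deriv fps_compose_mult_distrib mult.assoc del: fps_deriv_mult)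
  ultimately show ?case
    using Suc.prems by (simp add: hurwitz_Suc)
qed

lemma hurwitz_compositional_inverse:
  assumes u: "\<And>n. hurwitz n u" and u0: "u $ 0 = 1"
    and inv: "(fps_X * u) oo (fps_X * v) = fps_X"
  shows "hurwitz n v" "v $ 0 = 1"
proof -
  have "(fps_X * u) oo (fps_X * v) = fps_X * (v * (u oo (fps_X * v)))"
    by (simp add: fps_compose_mult_distrib mult.assoc)
  then have "v * (u oo (fps_X * v)) = 1"
    using inv by simp
  then have v: "v = inverse (u oo (fps_X * v))"
    using fps_inverse_unique by (metis mult.commute)
  show "v $ 0 = 1"
    by (subst v) (simp add: u0)
  \<comment> \<open>Composition with x v gains a degree, so the fixed-point equation for
    \<open>v\<close> passes from \<open>n - 1\<close> to \<open>n\<close>.\<close>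
  have *: "hurwitz n v" if "hurwitz (n - 1) v" for n
    by (subst v) (intro hurwitz_inverse hurwitz_compose_fps_X_mult u that, simp add: u0)
  show "hurwitz n v"
  proof (induction n)
    case 0
    show ?case using \<open>v $ 0 = 1\<close> by (simp add: hurwitz_0 one_mem)
  qed (simp add: *)
qed

text \<open>The danger is the factor 1 / m in the differential equation. For the derivative of
  \<open>b\<close> the hypothesis absorbs it; for that of u(x^m) the chain rule supplies a factor
  \<open>m\<close>.\<close>

lemma hurwitz_boettcher:
  assumes m: "m \<ge> 2" and b0: "b $ 0 = 1" and u0: "u $ 0 = 1"
    and b: "\<And>k. k \<ge> 1 \<Longrightarrow> of_nat (s ^ k * fact k) * b $ k / of_nat m \<in> R"
    and ode: "fps_deriv u = boettcher_rhs m b u"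
  shows "hurwitz n u"
proof (induction n)
  case 0
  show ?case using u0 by (simp add: hurwitz_0 one_mem)
next
  case (Suc n)
  let ?c = "fps_const (of_nat s / of_nat m) :: 'k fps"
  let ?U = "u oo fps_X ^ m" and ?B = "b oo (fps_X * u)"
  have "hurwitz n b"
    unfolding hurwitz_def
  proof safe
    fix k
    show "of_nat (s ^ k * fact k) * b $ k \<in> R"
      using mult_mem[OF of_nat_mem[of m] b[of k]] m b0 one_mem by (cases "k = 0") auto
  qed
  then have B: "hurwitz n ?B"
    by (rule hurwitz_compose_fps_X_mult) (use Suc in \<open>auto intro: hurwitz_mono\<close>)
  \<comment> \<open>In degree i this is the hypothesis on \<open>b\<close> at
    \<open>Suc i\<close>.\<close>
  have "hurwitz n (?c * fps_deriv b)"
    unfolding hurwitz_def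
  proof safe
    fix i
    show "of_nat (s ^ i * fact i) * (?c * fps_deriv b) $ i \<in> R"
      using b[of "Suc i"] by (simp add: algebra_simps add_divide_distrib)
  qed
  then have "hurwitz n (((?c * fps_deriv b) oo (fps_X * u)) * fps_deriv (fps_X * u))"
    by (rule hurwitz_mult[OF hurwitz_compose_fps_X_mult hurwitz_deriv_fps_X_mult])
      (use Suc in \<open>auto intro: hurwitz_mono\<close>)
  also have "((?c * fps_deriv b) oo (fps_X * u)) * fps_deriv (fps_X * u) = ?c * fps_deriv ?B"
    by (simp add: fps_compose_deriv fps_compose_mult_distrib mult.assoc del: fps_deriv_mult)
  finally have dB: "hurwitz n (?c * fps_deriv ?B)" .
  \<comment> \<open>A nonzero coefficient i = m k of \<open>?U\<close> is u_k with k \<le> i, and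
    s^k k! divides s^i i!.\<close>
  have U: "hurwitz n ?U"
    unfolding hurwitz_def
  proof safe
    fix i assume i: "i \<le> n"
    show "of_nat (s ^ i * fact i) * ?U $ i \<in> R"
    proof (cases "m dvd i")
      case True
      then obtain k where k: "i = m * k" by blast
      have "k \<le> i" using m k by simp
      then obtain q where q: "s ^ i * fact i = q * (s ^ k * fact k)"
        by (metis dvd_def fact_dvd le_imp_power_dvd mult_dvd_mono mult.commute)
      have "of_nat q * (of_nat (s ^ k * fact k) * u $ k) \<in> R"
        using Suc i \<open>k \<le> i\<close> unfolding hurwitz_def
        by (meson mult_mem of_nat_mem le_trans)
      moreover have "?U $ i = u $ k"
        using m k by (simp add: fps_nth_compose_X_power)
      ultimately show ?thesis
        unfolding q by (simp add: mult.assoc)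
    qed (simp add: fps_nth_compose_X_power zero_mem)
  qed
  \<comment> \<open>If i + 1 = m k, coefficient i of the derivative is m k u_k, which cancels the
    denominator \<open>m\<close>. Since m \<ge> 2 and k > 0, also k \<le> i, so the induction
    hypothesis covers u_k.\<close>
  have dU: "hurwitz n (?c * fps_deriv ?U)"
    unfolding hurwitz_def
  proof safe
    fix i assume i: "i \<le> n"
    show "of_nat (s ^ i * fact i) * (?c * fps_deriv ?U) $ i \<in> R"
    proof (cases "m dvd Suc i")
      case True
      then obtain k where k: "Suc i = m * k" by blast
      have "2 * k \<le> m * k" "k > 0" using m k by (auto intro: Nat.gr0I)
      then have "k \<le> i" using k by linarith
      then obtain q where q: "s ^ i * fact i = q * (s ^ k * fact k)"
        by (metis dvd_def fact_dvd le_imp_power_dvd mult_dvd_mono mult.commute)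
      have "of_nat (s * k * q) * (of_nat (s ^ k * fact k) * u $ k) \<in> R"
        using Suc i \<open>k \<le> i\<close> unfolding hurwitz_def
        by (meson mult_mem of_nat_mem le_trans)
      moreover have "(?c * fps_deriv ?U) $ i = of_nat (s * k) * u $ k"
      proof -
        have "fps_deriv ?U $ i = of_nat (m * k) * u $ k"
          using m k by (simp add: fps_nth_compose_X_power del: of_nat_Suc)
        then show ?thesis using m by simp
      qed
      ultimately show ?thesis
        unfolding q by (simp add: algebra_simps)
    qed (simp add: fps_nth_compose_X_power zero_mem)
  qed
  have c: "?c = fps_const (of_nat s) * fps_const (1 / of_nat m)"
    by simp
  \<comment> \<open>The factor s / m is moved onto each derivative, where it has been
    bounded.\<close>
  have "fps_const (of_nat s) * fps_deriv u =
      u * (?c * fps_deriv ?U * inverse ?U - ?c * fps_deriv ?B * inverse ?B)"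
    unfolding ode boettcher_rhs_def c by (simp only: algebra_simps)
  then have "hurwitz n (fps_const (of_nat s) * fps_deriv u)"
    using hurwitz_mult[OF Suc hurwitz_diff[OF hurwitz_mult[OF dU hurwitz_inverse[OF U]]
          hurwitz_mult[OF dB hurwitz_inverse[OF B]]]] u0 b0
    by simp
  then show ?case
    using u0 by (simp add: hurwitz_Suc one_mem)
qed

end

section \<open>Coefficients in a domain inside its fraction field\<close>

lemma hurwitz_series_fract: "hurwitz_series (range (to_fract :: 'a::{idom,ring_char_0} \<Rightarrow> 'a fract))"
proof
  show "1 \<in> range (to_fract :: 'a \<Rightarrow> _)"
    by (metis rangeI to_fract_1)
  show "x - y \<in> range (to_fract :: 'a \<Rightarrow> _)" "x * y \<in> range (to_fract :: 'a \<Rightarrow> _)"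
    if "x \<in> range to_fract" "y \<in> range to_fract" for x y
    using that by (auto simp flip: to_fract_diff to_fract_mult)
qed

text \<open>Keeping \<open>s\<close> general serves both bounds: they differ only in how the
  divisibility by \<open>m\<close> is verified.\<close>

lemma boettcher_hurwitz_coeffs:
  fixes b :: "nat \<Rightarrow> 'a::{idom,ring_char_0}"
  assumes m: "m \<ge> 2" and b0: "b 0 = 1" and s: "s > 0"
    and dvd: "\<And>k. k \<ge> 1 \<Longrightarrow> of_nat m dvd of_nat (s ^ k * fact k) * b k"
    and g: "g \<in> {boettcher m (fps_to_fract (fps_X ^ m * Abs_fps b)),
               fps_inv (boettcher m (fps_to_fract (fps_X ^ m * Abs_fps b)))}"
  shows "\<exists>a :: nat \<Rightarrow> 'a. a 0 = 1 \<and>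
           g = fps_X * Abs_fps (\<lambda>k. to_fract (a k) / of_nat (s ^ k * fact k))"
proof -
  interpret hurwitz_series "range (to_fract :: 'a \<Rightarrow> _)" s
    by (rule hurwitz_series_fract)
  define b' where "b' = fps_to_fract (Abs_fps b)"
  have b'0: "b' $ 0 = 1"
    by (simp add: b'_def fps_to_fract_def b0)
  have "fps_to_fract (fps_X ^ m * Abs_fps b) = fps_X ^ m * b'"
    by (rule fps_ext) (simp add: b'_def fps_to_fract_def fps_X_power_mult_nth)
  moreover obtain u where u: "boettcher m (fps_X ^ m * b') = fps_X * u" "u $ 0 = 1"
    "fps_deriv u = boettcher_rhs m b' u"
    using boettcher_factorization[OF m b'0] .
  ultimately have g': "g = fps_X * u \<or> g = fps_inv (fps_X * u)"
    using g by auto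
  have hu: "hurwitz n u" for n
  proof (rule hurwitz_boettcher[OF m b'0 u(2) _ u(3)])
    fix k :: nat assume "k \<ge> 1"
    then obtain c where c: "of_nat (s ^ k * fact k) * b k = of_nat m * c"
      using dvd by blast
    have "of_nat (s ^ k * fact k) * b' $ k = to_fract (of_nat (s ^ k * fact k) * b k)"
      by (simp only: b'_def fps_to_fract_def fps_nth_Abs_fps of_nat_fract_eq to_fract_mult)
    also have "\<dots> = of_nat m * to_fract c"
      by (simp only: c to_fract_mult of_nat_fract_eq)
    finally show "of_nat (s ^ k * fact k) * b' $ k / of_nat m \<in> range to_fract"
      using m by simp
  qed
  have "\<exists>v. g = fps_X * v \<and> v $ 0 = 1 \<and> (\<forall>n. hurwitz n v)"
    using g'
  proof
    assume "g = fps_X * u"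
    then show ?thesis using hu u by blast
  next
    assume g: "g = fps_inv (fps_X * u)"
    define v where "v = fps_shift 1 g"
    have "g = fps_X * v"
      unfolding v_def using g by (intro fps_ext) (simp add: fps_inv_def gr0_conv_Suc)
    moreover have "(fps_X * u) oo g = fps_X"
      unfolding g using u by (intro fps_inv_right) auto
    ultimately show ?thesis
      using hurwitz_compositional_inverse[OF hu u(2)] by blast
  qed
  then obtain v where v: "g = fps_X * v" "v $ 0 = 1" "\<And>n. hurwitz n v"
    by blast
  \<comment> \<open>The numerators come from the Hurwitz condition at its top degree, n = k.\<close>
  have "\<forall>k. \<exists>a. to_fract a = of_nat (s ^ k * fact k) * v $ k"
    using v(3) unfolding hurwitz_def by (metis imageE order_refl)
  then obtain a where a: "\<And>k. to_fract (a k) = of_nat (s ^ k * fact k) * v $ k"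
    by metis
  have "to_fract (a 0) = to_fract 1"
    by (simp only: a) (simp add: v)
  then have "a 0 = 1"
    by (simp only: to_fract_eq_iff)
  moreover have "v = Abs_fps (\<lambda>k. to_fract (a k) / of_nat (s ^ k * fact k))"
    using s by (intro fps_ext) (simp add: a)
  ultimately show ?thesis
    using v(1) by blast
qed

theorem theorem3:
  fixes m :: nat
    and b :: "nat \<Rightarrow> 'a::{idom, ring_char_0}"
    and \<phi> :: "'a fps"
    and f :: "'a fract fps"
  assumes "m \<ge> 2"
    and "\<phi> = fps_X ^ m * Abs_fps b"
    and "b 0 = 1"
    and "f = boettcher m (fps_to_fract \<phi>)"
  shows "(\<forall>g \<in> {f, fps_inv f}. \<exists>a :: nat \<Rightarrow> 'a. a 0 = 1 \<and>
            g = fps_X * Abs_fps (\<lambda>k. to_fract (a k) / of_nat (m ^ k * fact k))) \<and>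
         ((\<forall>k. 1 \<le> k \<and> k < m \<longrightarrow> of_nat m dvd fact k * b k) \<longrightarrow>
          (\<forall>g \<in> {f, fps_inv f}. \<exists>a :: nat \<Rightarrow> 'a. a 0 = 1 \<and>
            g = fps_X * Abs_fps (\<lambda>k. to_fract (a k) / of_nat (fact k)))) \<and>
         ((\<exists>h :: 'a fps. \<phi> = fps_X ^ m + of_nat m * fps_X ^ (m + 1) * h) \<longrightarrow>
          (\<forall>k. 1 \<le> k \<and> k < m \<longrightarrow> of_nat m dvd fact k * b k))"
proof (intro conjI impI)
  \<comment> \<open>For k \<ge> 1 the power m^k already contains the factor m.\<close>
  have "of_nat m dvd of_nat (m ^ k * fact k) * b k" if "k \<ge> 1" for k
    using that by (cases k) simp_all
  then show "\<forall>g \<in> {f, fps_inv f}. \<exists>a :: nat \<Rightarrow> 'a. a 0 = 1 \<and>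
      g = fps_X * Abs_fps (\<lambda>k. to_fract (a k) / of_nat (m ^ k * fact k))"
    using boettcher_hurwitz_coeffs[of m b m] assms by simp
next
  assume small: "\<forall>k. 1 \<le> k \<and> k < m \<longrightarrow> of_nat m dvd fact k * b k"
  have "of_nat m dvd of_nat (1 ^ k * fact k) * b k" if "k \<ge> 1" for k
  \<comment> \<open>The hypothesis covers k < m; from k = m on, m is itself a factor of k!.\<close>
  proof (cases "k < m")
    case False
    then have "m dvd fact k"
      using assms(1) by (intro dvd_fact) auto
    then have "(of_nat m :: 'a) dvd of_nat (fact k)"
      by (metis dvd_def of_nat_mult)
    then show ?thesis by simp
  qed (use small that in simp)
  then show "\<forall>g \<in> {f, fps_inv f}. \<exists>a :: nat \<Rightarrow> 'a. a 0 = 1 \<and>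
      g = fps_X * Abs_fps (\<lambda>k. to_fract (a k) / of_nat (fact k))"
    using boettcher_hurwitz_coeffs[of m b 1] assms by simp
next
  assume "\<exists>h :: 'a fps. \<phi> = fps_X ^ m + of_nat m * fps_X ^ (m + 1) * h"
  then obtain h where h: "\<phi> = fps_X ^ m + of_nat m * fps_X ^ (m + 1) * h" ..
  show "\<forall>k. 1 \<le> k \<and> k < m \<longrightarrow> of_nat m dvd fact k * b k"
  proof safe
    fix k assume "1 \<le> k" "k < m"
    have "b k = \<phi> $ (m + k)"
      by (simp add: assms(2) fps_X_power_mult_nth)
    \<comment> \<open>Shifting by m + 1 leaves index k - 1 of h; as k \<ge> 1, the term x^m does not
      contribute.\<close>
    also have "\<phi> = fps_X ^ m + fps_X ^ (m + 1) * (fps_const (of_nat m) * h)"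
      unfolding h by (simp add: fps_of_nat algebra_simps)
    also have "\<dots> $ (m + k) = of_nat m * h $ (k - 1)"
      using \<open>1 \<le> k\<close> by (simp only: fps_add_nth fps_X_power_mult_nth fps_X_power_nth) simp
    finally show "of_nat m dvd fact k * b k"
      by simp
  qed
qed

end
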